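(* Let $d\ge 1$ and let $X$ and $X_{\mathbf n}$, $\mathbf n\in\mathbb Z_+^d$, be real-valued random variables on a probability space $(\Omega,\mathcal F,P)$ (no assumption is made on their dependence). Assume there is a constant $M>0$ such that $$\frac{1}{|\mathbf n|}\sum_{\mathbf k\preceq \mathbf n}P(|X_{\mathbf k}|>x)\le M\,P(|X|>x)\qquad\text{for all } x\ge 0 \text{ and all } \mathbf n\in\mathbb Z_+^d .$$ Let $1<p<2$ and $1\le r\le p$. For a positive integer $n$ write $N=(n,\dots,n)\in\mathbb Z_+^d$, so $|N|=n^d$. If $E|X|^p<\infty$, then for every $\epsilon>0$ and for almost all $t\in\mathbb T^d$ (with respect to Lebesgue measure), $$\sum_{n=1}^{\infty}|N|^{p/r-1-1/d}\,P\Big(\max_{1\le m\le n}|S_{(m,\dots,m)}(t)|>\epsilon|N|^{1/r}\Big)<\infty .$$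
   Context: $\mathbb Z_+^d$ is the set of $d$-dimensional lattice points with positive integer coordinates. For $\mathbf k,\mathbf n\in\mathbb Z_+^d$, $\mathbf k\preceq\mathbf n$ means $k_i\le n_i$ for all $1\le i\le d$, and $|\mathbf n|=n_1n_2\cdots n_d$. $\mathbb T=[-\pi,\pi)$. For $t=(t_1,\dots,t_d)\in\mathbb T^d$, $\mathbf k\cdot t=k_1t_1+\cdots+k_dt_d$, and the discrete Fourier transform is $S_{\mathbf n}(t)=\sum_{\mathbf k\preceq\mathbf n}e^{i\mathbf k\cdot t}X_{\mathbf k}$; $S_{(m,\dots,m)}(t)$ is the cubic partial sum with all $d$ coordinates of the index equal to $m$. *)

theory Defs
  imports "HOL-Probability.Probability"
begin

definition pos_lattice :: "(nat ^ 'd) set" where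
  "pos_lattice = {n. \<forall>i. 1 \<le> n $ i}"

text \<open>The order on \<open>nat ^ 'd\<close> is the library's componentwise one.\<close>

definition index_box :: "nat ^ 'd \<Rightarrow> (nat ^ 'd) set" where
  "index_box n = {k \<in> pos_lattice. k \<le> n}"

definition index_vol :: "nat ^ 'd \<Rightarrow> nat" where
  "index_vol n = (\<Prod>i\<in>UNIV. n $ i)"

definition torus :: "(real ^ 'd) set" where
  "torus = {t. \<forall>i. t $ i \<in> {-pi..<pi}}"

definition phase :: "nat ^ 'd \<Rightarrow> real ^ 'd \<Rightarrow> real" where
  "phase k t = (\<Sum>i\<in>UNIV. real (k $ i) * t $ i)"

definition DFT :: "(nat ^ 'd \<Rightarrow> 'a \<Rightarrow> real) \<Rightarrow> nat ^ 'd \<Rightarrow> real ^ 'd \<Rightarrow> 'a \<Rightarrow> complex" where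
  "DFT X n t \<omega> =
    (\<Sum>k\<in>index_box n. exp (\<i> * complex_of_real (phase k t)) * complex_of_real (X k \<omega>))"

end

theory Submission
  imports Defs
begin

text \<open>
  Fix an exponent \<open>q\<close> strictly between \<open>p\<close> and \<open>2\<close>. For real coefficients \<open>a\<^sub>k\<close>, orthogonality of the
  characters and \<open>\<ell>\<^sup>q \<subseteq> \<ell>\<^sup>2\<close> bound the squared \<open>L\<^sup>2\<close> norm of any increment of the cubic partial sums by
  \<open>(\<Sum>\<bar>a\<^sub>k\<bar>\<^sup>q)\<^bsup>2/q\<^esup>\<close>. As \<open>2/q > 1\<close>, this is strictly superadditive, so a bisection argument
  (in the style of Christ and Kiselev) transfers the bound to the maximal function; no Carleson-type theorem is
  needed. Chebyshev's inequality then gives, for every \<open>l > 0\<close>, the weak-type estimate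
  \<open>Leb {t. max\<^sub>m \<bar>S\<^sub>m(t)\<bar> > l} \<le> C \<Sum> min ((\<bar>a\<^sub>k\<bar>/l)\<^sup>q) 1\<close>.

  Applied to \<open>a\<^sub>k = X\<^sub>k(\<omega>)\<close> for each \<open>\<omega>\<close> separately, it needs no information on the dependence. Taking
  expectations, the weak mean domination replaces \<open>X\<^sub>k\<close> by the dominating variable, and since \<open>q > p\<close> the
  weighted sum over \<open>n\<close> of its truncated moments is at most a multiple of its \<open>p\<close>-th absolute moment. So the series
  is integrable over the torus, hence finite almost everywhere.
\<close>

section \<open>A maximal inequality by bisection\<close>

text \<open>
  A constant \<open>K\<close> as required exists as soon as \<open>\<eta>\<close> is so small that \<open>(1 + \<eta>) * 2 powr (1 - s) < 1\<close>: the index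
  interval is cut where \<open>W\<close> reaches half of its increase, and each half contributes at most \<open>2 powr (- s)\<close> times the
  full bound.
\<close>

lemma bisection_maximal_inequality:
  fixes S :: "nat \<Rightarrow> 'b \<Rightarrow> complex" and W :: "nat \<Rightarrow> real"
  assumes meas: "\<And>m. S m \<in> borel_measurable N"
    and mono: "mono W" and s: "s > 1" and "C \<ge> 0" and "\<eta> > 0" and "K \<ge> 0"
    and K: "(1 + 1 / \<eta>) * C + (1 + \<eta>) * 2 powr (1 - s) * K \<le> K"
    and incr: "\<And>a b. a \<le> b \<Longrightarrow>
      (\<integral>\<^sup>+x. ennreal ((cmod (S b x - S a x))\<^sup>2) \<partial>N) \<le> ennreal (C * (W b - W a) powr s)"
    and "a \<le> b"
  shows "(\<integral>\<^sup>+x. (SUP m\<in>{a..b}. ennreal ((cmod (S m x - S a x))\<^sup>2)) \<partial>N)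
           \<le> ennreal (K * (W b - W a) powr s)"
  using \<open>a \<le> b\<close>
proof (induction "b - a" arbitrary: a b rule: less_induct)
  case less
  define G where "G a b x = (SUP m\<in>{a..b}. ennreal ((cmod (S m x - S a x))\<^sup>2))" for a b :: nat and x
  have G_meas [measurable]: "G a b \<in> borel_measurable N" for a b
    unfolding G_def using meas by measurable
  note meas [measurable]
  show ?case
  proof (cases "a = b")
    case True
    then show ?thesis by simp
  next
    case False
    with less have "a < b" by simp
    define V where "V = W b - W a"
    have "V \<ge> 0" using mono \<open>a \<le> b\<close> by (simp add: V_def monoD)
    \<comment> \<open>The last index before \<open>b\<close> at which \<open>W\<close> has made at
      most half of its increase. The jump from \<open>h\<close> to \<open>Suc h\<close> may carry
      any share of it, so the recursion uses \<open>{a..h}\<close> and \<open>{Suc h..b}\<close>,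
      both strictly shorter than \<open>{a..b}\<close>.\<close>
    define h where "h = (GREATEST h. h < b \<and> a \<le> h \<and> W h - W a \<le> V / 2)"
    have ex: "a < b \<and> a \<le> a \<and> W a - W a \<le> V / 2" using \<open>a < b\<close> \<open>V \<ge> 0\<close> by simp
    have h: "h < b \<and> a \<le> h \<and> W h - W a \<le> V / 2"
      unfolding h_def by (rule GreatestI_nat[where P="\<lambda>h. h < b \<and> a \<le> h \<and> W h - W a \<le> V / 2", OF ex, of b]) auto
    have right: "W b - W (Suc h) \<le> V / 2"
    proof (cases "Suc h < b")
      case True
      \<comment> \<open>Otherwise \<open>Suc h\<close> would be a larger admissible cut than
        \<open>h\<close>.\<close>
      have "\<not> W (Suc h) - W a \<le> V / 2"
      proof
        assume "W (Suc h) - W a \<le> V / 2"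
        then have "Suc h \<le> h"
          unfolding h_def
          by (intro Greatest_le_nat[where b=b]) (use True h in \<open>auto simp: h_def\<close>)
        then show False by simp
      qed
      then show ?thesis by (simp add: V_def field_simps)
    next
      case False
      then have "Suc h = b" using h by simp
      then show ?thesis using \<open>V \<ge> 0\<close> by simp
    qed
    have half: "K * D powr s \<le> K * (V / 2) powr s" if "0 \<le> D" "D \<le> V / 2" for D
      using that s \<open>K \<ge> 0\<close> by (intro mult_left_mono powr_mono2) auto
    have left_IH: "(\<integral>\<^sup>+x. G a h x \<partial>N) \<le> ennreal (K * (V / 2) powr s)"
    proof -
      have "(\<integral>\<^sup>+x. G a h x \<partial>N) \<le> ennreal (K * (W h - W a) powr s)"
        unfolding G_def using h less.prems by (intro less.hyps) auto
      also have "\<dots> \<le> ennreal (K * (V / 2) powr s)"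
        using h mono by (intro ennreal_leI half) (auto simp: monoD)
      finally show ?thesis .
    qed
    have right_IH: "(\<integral>\<^sup>+x. G (Suc h) b x \<partial>N) \<le> ennreal (K * (V / 2) powr s)"
    proof -
      have "(\<integral>\<^sup>+x. G (Suc h) b x \<partial>N) \<le> ennreal (K * (W b - W (Suc h)) powr s)"
        unfolding G_def using h less.prems by (intro less.hyps) auto
      also have "\<dots> \<le> ennreal (K * (V / 2) powr s)"
        using h mono right by (intro ennreal_leI half) (auto simp: monoD)
      finally show ?thesis .
    qed
    have mid: "(\<integral>\<^sup>+x. ennreal ((cmod (S (Suc h) x - S a x))\<^sup>2) \<partial>N) \<le> ennreal (C * V powr s)"
    proof -
      have "(\<integral>\<^sup>+x. ennreal ((cmod (S (Suc h) x - S a x))\<^sup>2) \<partial>N) \<le> ennreal (C * (W (Suc h) - W a) powr s)"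
        using h by (intro incr) auto
      also have "\<dots> \<le> ennreal (C * V powr s)"
        using h mono s \<open>C \<ge> 0\<close> by (intro ennreal_leI mult_left_mono powr_mono2) (auto simp: V_def monoD)
      finally show ?thesis .
    qed
    \<comment> \<open>Up to \<open>h\<close> the first block controls the maximum. Beyond it the sum
      restarts at \<open>Suc h\<close>; the increment from \<open>a\<close> to \<open>Suc h\<close>
      takes the large factor \<open>1 + 1 / \<eta>\<close>, so that the recursive terms carry only
      \<open>1 + \<eta>\<close>.\<close>
    have split: "G a b x \<le> ennreal (1 + 1 / \<eta>) * ennreal ((cmod (S (Suc h) x - S a x))\<^sup>2)
                   + ennreal (1 + \<eta>) * (G a h x + G (Suc h) b x)" for x
      unfolding G_def[of a b]
    proof (rule SUP_least)
      fix m assume m: "m \<in> {a..b}"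
      show "ennreal ((cmod (S m x - S a x))\<^sup>2)
          \<le> ennreal (1 + 1 / \<eta>) * ennreal ((cmod (S (Suc h) x - S a x))\<^sup>2)
                   + ennreal (1 + \<eta>) * (G a h x + G (Suc h) b x)"
      proof (cases "m \<le> h")
        case True
        have "ennreal ((cmod (S m x - S a x))\<^sup>2) \<le> G a h x"
          unfolding G_def using m True by (intro SUP_upper) auto
        also have "\<dots> \<le> 1 * (G a h x + G (Suc h) b x)" by simp
        also have "\<dots> \<le> ennreal (1 + \<eta>) * (G a h x + G (Suc h) b x)"
          using \<open>\<eta> > 0\<close> by (intro mult_right_mono) auto
        finally show ?thesis by (simp add: add_increasing)
      next
        case False
        define u v where "u = cmod (S (Suc h) x - S a x)" and "v = cmod (S m x - S (Suc h) x)"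
        have "(cmod (S m x - S a x))\<^sup>2 \<le> (u + v)\<^sup>2"
          unfolding u_def v_def using norm_triangle_ineq[of "S (Suc h) x - S a x" "S m x - S (Suc h) x"]
          by (intro power_mono) auto
        also have "\<dots> \<le> (1 + 1 / \<eta>) * u\<^sup>2 + (1 + \<eta>) * v\<^sup>2"
        proof -
          \<comment> \<open>This square is exactly the gap in the weighted inequality for
            \<open>(u + v)\<^sup>2\<close>.\<close>
          have "0 \<le> (u - \<eta> * v)\<^sup>2 / \<eta>" using \<open>\<eta> > 0\<close> by simp
          also have "\<dots> = (1 + 1 / \<eta>) * u\<^sup>2 + (1 + \<eta>) * v\<^sup>2 - (u + v)\<^sup>2"
            using \<open>\<eta> > 0\<close> by (simp add: field_simps power2_eq_square)
          finally show ?thesis by simp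
        qed
        finally have "ennreal ((cmod (S m x - S a x))\<^sup>2)
            \<le> ennreal (1 + 1 / \<eta>) * ennreal (u\<^sup>2) + ennreal (1 + \<eta>) * ennreal (v\<^sup>2)"
          using \<open>\<eta> > 0\<close> by (simp flip: ennreal_mult ennreal_plus)
        also have "ennreal (v\<^sup>2) \<le> G (Suc h) b x"
          unfolding G_def v_def using m False by (intro SUP_upper) auto
        also have "\<dots> \<le> G a h x + G (Suc h) b x" by simp
        finally show ?thesis by (simp add: u_def add_mono mult_left_mono)
      qed
    qed
    have "(\<integral>\<^sup>+x. G a b x \<partial>N) \<le> (\<integral>\<^sup>+x. ennreal (1 + 1 / \<eta>) * ennreal ((cmod (S (Suc h) x - S a x))\<^sup>2)
                   + ennreal (1 + \<eta>) * (G a h x + G (Suc h) b x) \<partial>N)"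
      by (intro nn_integral_mono split)
    also have "\<dots> = ennreal (1 + 1 / \<eta>) * (\<integral>\<^sup>+x. ennreal ((cmod (S (Suc h) x - S a x))\<^sup>2) \<partial>N)
                   + ennreal (1 + \<eta>) * ((\<integral>\<^sup>+x. G a h x \<partial>N) + (\<integral>\<^sup>+x. G (Suc h) b x \<partial>N))"
      by (simp add: nn_integral_add nn_integral_cmult)
    also have "\<dots> \<le> ennreal (1 + 1 / \<eta>) * ennreal (C * V powr s)
                   + ennreal (1 + \<eta>) * (ennreal (K * (V / 2) powr s) + ennreal (K * (V / 2) powr s))"
      by (intro add_mono mult_left_mono mid left_IH right_IH) auto
    also have "\<dots> = ennreal (((1 + 1 / \<eta>) * C + (1 + \<eta>) * 2 powr (1 - s) * K) * V powr s)"
    proof -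
      have "2 * (V / 2) powr s = 2 powr (1 - s) * V powr s"
        using \<open>V \<ge> 0\<close> by (simp add: powr_divide powr_diff)
      then have "(1 + 1 / \<eta>) * (C * V powr s) + (1 + \<eta>) * (K * (V / 2) powr s + K * (V / 2) powr s)
          = ((1 + 1 / \<eta>) * C + (1 + \<eta>) * 2 powr (1 - s) * K) * V powr s"
        by (simp add: algebra_simps)
      then show ?thesis
        using \<open>\<eta> > 0\<close> \<open>C \<ge> 0\<close> \<open>K \<ge> 0\<close> by (simp flip: ennreal_mult ennreal_plus)
    qed
    also have "\<dots> \<le> ennreal (K * V powr s)"
      using K by (intro ennreal_leI mult_right_mono) auto
    finally show ?thesis by (simp add: G_def V_def)
  qed
qed

section \<open>Trigonometric sums on the torus\<close>

text \<open>The primitive \<open>F\<close> takes equal values at both ends of a full period.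
  \<open>m\<close> is a real number with integer value because differences of natural frequencies,
  possibly negative, are inserted for it.\<close>

lemma integral_exp_int_multiple:
  fixes m :: real
  assumes "m \<in> \<int>" "m \<noteq> 0"
  shows "(\<integral>x. indicator {-pi..<pi} x *\<^sub>R exp (\<i> * complex_of_real (m * x)) \<partial>lborel) = 0"
proof -
  define F where "F x = exp (\<i> * complex_of_real (m * x)) / (\<i> * complex_of_real m)" for x
  have "(\<integral>x. indicator {-pi..<pi} x *\<^sub>R exp (\<i> * complex_of_real (m * x)) \<partial>lborel)
      = (\<integral>x. indicator {-pi..pi} x *\<^sub>R exp (\<i> * complex_of_real (m * x)) \<partial>lborel)"
  proof (rule integral_cong_AE)
    \<comment> \<open>The intervals differ in the null set \<open>{pi}\<close>; the fundamental
      theorem of calculus asks for the closed one.\<close>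
    show "AE x in lborel. indicator {-pi..<pi} x *\<^sub>R exp (\<i> * complex_of_real (m * x))
        = indicator {-pi..pi} x *\<^sub>R exp (\<i> * complex_of_real (m * x))"
      using AE_lborel_singleton[of pi] by eventually_elim (auto simp: indicator_def)
  qed auto
  also have "\<dots> = F pi - F (- pi)"
  proof (rule integral_FTC_atLeastAtMost)
    show "(F has_vector_derivative exp (\<i> * complex_of_real (m * x))) (at x within {-pi..pi})" for x
    proof -
      have "((\<lambda>z. exp (\<i> * (complex_of_real m * z)) / (\<i> * complex_of_real m)) has_field_derivative
          exp (\<i> * (complex_of_real m * complex_of_real x))) (at (complex_of_real x))"
        using assms by (auto intro!: derivative_eq_intros simp: mult_ac)
      then show ?thesis
        unfolding F_def of_real_mult
        by (rule has_vector_derivative_real_field[THEN has_vector_derivative_at_within])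
    qed
  qed (auto intro!: continuous_intros)
  also have "F pi = F (- pi)"
  proof -
    obtain j where j: "m = of_int j" using assms by (auto elim: Ints_cases)
    \<comment> \<open>The two exponents differ by \<open>2 * pi * \<i> * j\<close>.\<close>
    have "exp (\<i> * complex_of_real (m * pi)) = exp (\<i> * complex_of_real (m * (- pi)))"
      unfolding exp_eq by (rule exI[of _ j]) (simp add: j)
    then show ?thesis by (simp add: F_def)
  qed
  finally show ?thesis by simp
qed

text \<open>Fubini's theorem: \<open>lborel\<close> is the image of the product of one-dimensional
  Lebesgue measures, indexed by \<open>Basis\<close>, under the map that assembles a vector from its
  coordinates.\<close>

lemma integral_lborel_prod:
  fixes g :: "'a::euclidean_space \<Rightarrow> real \<Rightarrow> complex"
  assumes int: "\<And>b. b \<in> Basis \<Longrightarrow> integrable lborel (g b)"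
  shows "(\<integral>t. (\<Prod>b\<in>Basis. g b (t \<bullet> b)) \<partial>lborel) = (\<Prod>b\<in>Basis. \<integral>x. g b x \<partial>lborel)"
proof -
  interpret product_sigma_finite "\<lambda>_::'a. lborel :: real measure" ..
  have [measurable]: "g b \<in> borel_measurable borel" if "b \<in> Basis" for b
    using borel_measurable_integrable[OF int[OF that]] by simp
  have "(\<integral>t. (\<Prod>b\<in>Basis. g b (t \<bullet> b)) \<partial>lborel)
      = (\<integral>x. (\<Prod>b\<in>Basis. g b ((\<Sum>c\<in>Basis. x c *\<^sub>R c) \<bullet> b)) \<partial>(\<Pi>\<^sub>M b\<in>(Basis::'a set). lborel))"
    by (subst lborel_eq) (rule integral_distr; measurable)
  also have "\<dots> = (\<integral>x. (\<Prod>b\<in>Basis. g b (x b)) \<partial>(\<Pi>\<^sub>M b\<in>(Basis::'a set). lborel))"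
    by (intro Bochner_Integration.integral_cong prod.cong) (simp_all add: inner_sum_left_Basis)
  also have "\<dots> = (\<Prod>b\<in>Basis. \<integral>x. g b x \<partial>lborel)"
    by (rule product_integral_prod) (use int in auto)
  finally show ?thesis .
qed

lemma torus_eq_Basis: "torus = {t :: real ^ 'd. \<forall>b\<in>Basis. t \<bullet> b \<in> {-pi..<pi}}"
  by (auto simp: torus_def Basis_vec_def inner_axis)

lemma torus_borel [measurable]: "(torus :: (real ^ 'd) set) \<in> sets borel"
proof -
  have "(torus :: (real ^ 'd) set) = {t \<in> space borel. \<forall>b\<in>Basis. - pi \<le> t \<bullet> b \<and> t \<bullet> b < pi}"
    by (auto simp: torus_eq_Basis)
  also have "\<dots> \<in> sets borel" by measurable
  finally show ?thesis .
qed

text \<open>Not normalised: the total mass stays as a factor in Parseval's identity.\<close>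

abbreviation torus_measure :: "(real ^ 'd) measure" where
  "torus_measure \<equiv> restrict_space lborel torus"

lemma finite_measure_torus: "finite_measure (torus_measure :: (real ^ 'd) measure)"
proof
  have "torus \<subseteq> cbox (- (\<chi> i. pi)) (\<chi> i. pi :: real ^ 'd)"
    proof
    fix t :: "real ^ 'd" assume "t \<in> torus"
    then have "- pi \<le> t $ i" "t $ i \<le> pi" for i by (simp_all add: torus_def less_imp_le)
    then show "t \<in> cbox (- (\<chi> i. pi)) (\<chi> i. pi :: real ^ 'd)" by (simp add: mem_box_cart)
  qed
  then have "emeasure lborel (torus :: (real ^ 'd) set) \<le> emeasure lborel (cbox (- (\<chi> i. pi)) (\<chi> i. pi :: real ^ 'd))"
    by (intro emeasure_mono) auto
  also have "\<dots> < \<infinity>" by (rule emeasure_lborel_cbox_finite)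
  finally show "emeasure torus_measure (space (torus_measure :: (real ^ 'd) measure)) \<noteq> \<infinity>"
    by (simp add: space_restrict_space emeasure_restrict_space)
qed

lemma phase_measurable [measurable]: "phase k \<in> borel_measurable borel"
  unfolding phase_def by measurable

lemma phase_torus_measurable [measurable]:
  "phase k \<in> borel_measurable torus_measure"
  by (rule measurable_restrict_space1) simp

text \<open>The integrand factors over the coordinates, and a coordinate where \<open>k\<close> and
  \<open>l\<close> differ contributes a vanishing integral over a full period.\<close>

lemma character_orthogonality:
  fixes k l :: "nat ^ 'd"
  assumes "k \<noteq> l"
  shows "(\<integral>t. exp (\<i> * complex_of_real (phase k t - phase l t)) \<partial>torus_measure) = 0"
proof -
  \<comment> \<open>The subtraction is made in the reals; on natural numbers it would
    truncate.\<close>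
  define \<theta> :: "real ^ 'd" where "\<theta> = (\<chi> i. real (k $ i) - real (l $ i))"
  define g :: "real ^ 'd \<Rightarrow> real \<Rightarrow> complex"
    where "g b x = indicator {-pi..<pi} x *\<^sub>R exp (\<i> * complex_of_real ((\<theta> \<bullet> b) * x))" for b x
  have phase: "phase k t - phase l t = (\<Sum>b\<in>Basis. (\<theta> \<bullet> b) * (t \<bullet> b))" for t
  proof -
    have "phase k t - phase l t = \<theta> \<bullet> t"
      by (simp add: phase_def \<theta>_def inner_vec_def sum_subtractf left_diff_distrib)
    then show ?thesis by (rule trans[OF _ euclidean_inner])
  qed
  have prod: "indicator torus t *\<^sub>R exp (\<i> * complex_of_real (phase k t - phase l t))
      = (\<Prod>b\<in>Basis. g b (t \<bullet> b))" for t
  proof -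
    have "(\<Prod>b\<in>Basis. g b (t \<bullet> b)) = (\<Prod>b\<in>Basis. complex_of_real (indicator {-pi..<pi} (t \<bullet> b)))
        * (\<Prod>b\<in>Basis. exp (\<i> * complex_of_real ((\<theta> \<bullet> b) * (t \<bullet> b))))"
      unfolding g_def scaleR_conv_of_real prod.distrib ..
    also have "(\<Prod>b\<in>Basis. exp (\<i> * complex_of_real ((\<theta> \<bullet> b) * (t \<bullet> b))))
        = exp (\<i> * complex_of_real (phase k t - phase l t))"
      unfolding phase of_real_sum sum_distrib_left exp_sum[OF finite_Basis] ..
    also have "(\<Prod>b\<in>Basis. complex_of_real (indicator {-pi..<pi} (t \<bullet> b))) = of_real (indicator torus t)"
      by (auto simp: torus_eq_Basis indicator_def prod_zero_iff)
    finally show ?thesis by (simp add: scaleR_conv_of_real)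
  qed
  have g_int: "integrable lborel (g b)" for b
    unfolding g_def
  proof (rule integrableI_bounded_set_indicator[where B = 1])
    show "emeasure lborel {-pi..<pi} < \<infinity>" by simp
  qed auto
  obtain i where i: "k $ i \<noteq> l $ i" using assms by (auto simp: vec_eq_iff)
  have "axis i 1 \<in> (Basis :: (real ^ 'd) set)" by (auto simp: Basis_vec_def)
  moreover have "(\<integral>x. g (axis i 1) x \<partial>lborel) = 0"
    unfolding g_def
    by (rule integral_exp_int_multiple) (use i in \<open>auto simp: \<theta>_def inner_axis\<close>)
  ultimately have zero: "(\<Prod>b\<in>Basis. \<integral>x. g b x \<partial>lborel) = 0"
    by (auto simp: prod_zero_iff)
  have "(\<integral>t. exp (\<i> * complex_of_real (phase k t - phase l t)) \<partial>torus_measure)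
      = (\<integral>t. (\<Prod>b\<in>Basis. g b (t \<bullet> b)) \<partial>lborel)"
    by (subst integral_restrict_space) (simp_all add: prod del: of_real_diff)
  also have "\<dots> = 0" using integral_lborel_prod[of g] g_int zero by simp
  finally show ?thesis .
qed

text \<open>Parseval's identity for a trigonometric polynomial: the squared modulus expands to a
  double sum, of which orthogonality leaves the diagonal.\<close>

lemma nn_integral_norm_trig_sum:
  fixes a :: "nat ^ 'd \<Rightarrow> real"
  assumes "finite A"
  shows "(\<integral>\<^sup>+t. ennreal ((cmod (\<Sum>k\<in>A. exp (\<i> * complex_of_real (phase k t)) * complex_of_real (a k)))\<^sup>2) \<partial>torus_measure)
           = ennreal (measure lborel (torus :: (real ^ 'd) set) * (\<Sum>k\<in>A. (a k)\<^sup>2))"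
proof -
  interpret finite_measure "torus_measure :: (real ^ 'd) measure" by (rule finite_measure_torus)
  define e where "e k t = exp (\<i> * complex_of_real (phase k t))" for k :: "nat ^ 'd" and t
  define T where "T t = (\<Sum>k\<in>A. e k t * complex_of_real (a k))" for t
  have e_meas [measurable]: "e k \<in> borel_measurable torus_measure" for k
    unfolding e_def by measurable
  have T_meas [measurable]: "T \<in> borel_measurable torus_measure"
    unfolding T_def by measurable
  have int1: "integrable torus_measure (\<lambda>t. exp (\<i> * complex_of_real (phase k t - phase l t)))" for k l :: "nat ^ 'd"
    by (rule integrable_const_bound[where B = 1]) auto
  have sq: "complex_of_real ((cmod (T t))\<^sup>2)
      = (\<Sum>k\<in>A. \<Sum>l\<in>A. complex_of_real (a k * a l) * exp (\<i> * complex_of_real (phase k t - phase l t)))" for t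
  proof -
    have "complex_of_real ((cmod (T t))\<^sup>2) = T t * cnj (T t)" by (rule complex_norm_square)
    also have "\<dots> = (\<Sum>k\<in>A. \<Sum>l\<in>A. (e k t * complex_of_real (a k)) * (cnj (e l t) * complex_of_real (a l)))"
      by (simp add: T_def sum_product)
    also have "\<dots> = (\<Sum>k\<in>A. \<Sum>l\<in>A. complex_of_real (a k * a l) * exp (\<i> * complex_of_real (phase k t - phase l t)))"
    proof (intro sum.cong refl)
      fix k l
      have "exp (\<i> * complex_of_real (phase k t - phase l t)) = e k t * cnj (e l t)"
        by (simp add: e_def exp_cnj right_diff_distrib flip: exp_add)
      then show "(e k t * complex_of_real (a k)) * (cnj (e l t) * complex_of_real (a l))
          = complex_of_real (a k * a l) * exp (\<i> * complex_of_real (phase k t - phase l t))"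
        by simp
    qed
    finally show ?thesis .
  qed
  \<comment> \<open>The computation runs in the complex numbers, where the characters live;
    injectivity of the embedding brings it back.\<close>
  have "complex_of_real (\<integral>t. (cmod (T t))\<^sup>2 \<partial>torus_measure) = (\<integral>t. complex_of_real ((cmod (T t))\<^sup>2) \<partial>torus_measure)"
    by (rule integral_complex_of_real[symmetric])
  also have "\<dots> = (\<Sum>k\<in>A. \<Sum>l\<in>A. complex_of_real (a k * a l) *
      (\<integral>t. exp (\<i> * complex_of_real (phase k t - phase l t)) \<partial>torus_measure))"
    unfolding sq by (simp add: int1 del: of_real_diff of_real_mult)
  also have "\<dots> = (\<Sum>k\<in>A. complex_of_real (a k * a k) * measure lborel (torus :: (real ^ 'd) set))"
  proof (intro sum.cong refl)
    fix k assume "k \<in> A"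
    have "(\<Sum>l\<in>A. complex_of_real (a k * a l) *
        (\<integral>t. exp (\<i> * complex_of_real (phase k t - phase l t)) \<partial>torus_measure))
      = (\<Sum>l\<in>A. if l = k then complex_of_real (a k * a k) * measure lborel (torus :: (real ^ 'd) set) else 0)"
    proof (intro sum.cong refl)
      fix l
      show "complex_of_real (a k * a l) * (\<integral>t. exp (\<i> * complex_of_real (phase k t - phase l t)) \<partial>torus_measure)
          = (if l = k then complex_of_real (a k * a k) * measure lborel (torus :: (real ^ 'd) set) else 0)"
      proof (cases "l = k")
        case True
        then show ?thesis
          by (simp add: measure_restrict_space space_restrict_space scaleR_conv_of_real)
      next
        case False
        then have "(\<integral>t. exp (\<i> * complex_of_real (phase k t - phase l t)) \<partial>torus_measure) = 0"
          by (intro character_orthogonality) auto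
        then show ?thesis using False by simp
      qed
    qed
    then show "(\<Sum>l\<in>A. complex_of_real (a k * a l) *
        (\<integral>t. exp (\<i> * complex_of_real (phase k t - phase l t)) \<partial>torus_measure))
      = complex_of_real (a k * a k) * measure lborel (torus :: (real ^ 'd) set)"
      using assms \<open>k \<in> A\<close> by simp
  qed
  also have "\<dots> = complex_of_real (measure lborel (torus :: (real ^ 'd) set) * (\<Sum>k\<in>A. (a k)\<^sup>2))"
    by (simp add: sum_distrib_left power2_eq_square mult.commute)
  finally have eq: "(\<integral>t. (cmod (T t))\<^sup>2 \<partial>torus_measure) = measure lborel (torus :: (real ^ 'd) set) * (\<Sum>k\<in>A. (a k)\<^sup>2)"
    by (simp only: of_real_eq_iff)
  \<comment> \<open>A bounded function on a space of finite measure. Integrability is what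
    identifies the Bochner integral just computed with the nonnegative integral.\<close>
  have "integrable torus_measure (\<lambda>t. (cmod (T t))\<^sup>2)"
  proof (rule integrable_const_bound[where B = "(\<Sum>k\<in>A. \<bar>a k\<bar>)\<^sup>2"])
    have "cmod (T t) \<le> (\<Sum>k\<in>A. \<bar>a k\<bar>)" for t
      unfolding T_def by (rule sum_norm_le) (simp add: e_def norm_mult)
    then show "AE t in torus_measure. norm ((cmod (T t))\<^sup>2) \<le> (\<Sum>k\<in>A. \<bar>a k\<bar>)\<^sup>2"
      by (auto intro!: power_mono AE_I2)
  qed measurable
  then show ?thesis
    using eq by (simp add: nn_integral_eq_integral T_def e_def)
qed

text \<open>Each \<open>\<bar>a k\<bar> powr q\<close> is at most the whole sum \<open>V\<close>. So
  the square, split as \<open>\<bar>a k\<bar> powr q * (\<bar>a k\<bar> powr q) powr (2 / q -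
  1)\<close>, is at most \<open>\<bar>a k\<bar> powr q * V powr (2 / q - 1)\<close>, and the first
  factors add up to \<open>V\<close>.\<close>

lemma sum_power2_le_sum_powr:
  fixes a :: "'i \<Rightarrow> real"
  assumes "finite A" "0 < q" "q \<le> 2"
  shows "(\<Sum>k\<in>A. (a k)\<^sup>2) \<le> (\<Sum>k\<in>A. \<bar>a k\<bar> powr q) powr (2 / q)"
proof -
  define V where "V = (\<Sum>k\<in>A. \<bar>a k\<bar> powr q)"
  have "V \<ge> 0" by (simp add: V_def sum_nonneg)
  have "(a k)\<^sup>2 \<le> \<bar>a k\<bar> powr q * V powr (2 / q - 1)" if "k \<in> A" for k
  proof -
    have "\<bar>a k\<bar> powr q \<le> V"
      unfolding V_def by (rule member_le_sum) (use that assms in auto)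
    have "(a k)\<^sup>2 = \<bar>a k\<bar> powr 2"
      by (cases "a k = 0") simp_all
    also have "\<dots> = \<bar>a k\<bar> powr q * (\<bar>a k\<bar> powr q) powr (2 / q - 1)"
    proof -
      have "\<bar>a k\<bar> powr q * (\<bar>a k\<bar> powr q) powr (2 / q - 1) = \<bar>a k\<bar> powr (q + q * (2 / q - 1))"
        unfolding powr_powr powr_add ..
      also have "q + q * (2 / q - 1) = 2" using assms by (simp add: right_diff_distrib)
      finally show ?thesis by simp
    qed
    also have "\<dots> \<le> \<bar>a k\<bar> powr q * V powr (2 / q - 1)"
      using assms \<open>\<bar>a k\<bar> powr q \<le> V\<close> by (intro mult_left_mono powr_mono2) auto
    finally show ?thesis .
  qed
  then have "(\<Sum>k\<in>A. (a k)\<^sup>2) \<le> (\<Sum>k\<in>A. \<bar>a k\<bar> powr q * V powr (2 / q - 1))"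
    by (rule sum_mono)
  also have "\<dots> = V * V powr (2 / q - 1)" by (simp add: V_def sum_distrib_right)
  also have "\<dots> = V powr (2 / q)"
    using \<open>V \<ge> 0\<close> by (cases "V = 0") (simp_all add: powr_diff)
  finally show ?thesis by (simp add: V_def)
qed

section \<open>The weak-type maximal estimate\<close>

lemma finite_index_box: "finite (index_box n :: (nat ^ 'd) set)"
proof -
  have "index_box n \<subseteq> vec_lambda ` (\<Pi>\<^sub>E i\<in>UNIV. {..n $ i})"
  proof
    fix k assume "k \<in> index_box n"
    then have "vec_nth k \<in> (\<Pi>\<^sub>E i\<in>UNIV. {..n $ i})"
      by (auto simp: index_box_def less_eq_vec_def)
    then show "k \<in> vec_lambda ` (\<Pi>\<^sub>E i\<in>UNIV. {..n $ i})"
      by (intro image_eqI[of _ _ "vec_nth k"]) simp_all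
  qed
  then show ?thesis by (rule finite_subset) (intro finite_imageI finite_PiE; simp)
qed

lemma index_box_vec_mono: "m \<le> n \<Longrightarrow> index_box (vec m) \<subseteq> index_box (vec n)"
  by (auto simp: index_box_def less_eq_vec_def intro: order_trans)

text \<open>Makes the partial sum of index 0 vanish, so that increments from index 0 are the partial
  sums themselves.\<close>

lemma index_box_0: "index_box (0 :: nat ^ 'd) = {}"
  by (auto simp: index_box_def pos_lattice_def less_eq_vec_def)

lemma index_vol_vec: "index_vol (vec n :: nat ^ 'd) = n ^ CARD('d)"
  by (simp add: index_vol_def)

text \<open>The transform with deterministic coefficients, for estimates in \<open>t\<close> at a
  fixed outcome.\<close>

definition trig_sum :: "(nat ^ 'd \<Rightarrow> real) \<Rightarrow> (nat ^ 'd) set \<Rightarrow> real ^ 'd \<Rightarrow> complex" where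
  "trig_sum a A t = (\<Sum>k\<in>A. exp (\<i> * complex_of_real (phase k t)) * complex_of_real (a k))"

lemma trig_sum_measurable [measurable]: "trig_sum a A \<in> borel_measurable torus_measure"
  unfolding trig_sum_def by measurable

text \<open>The difference is the trigonometric sum over the shell between two boxes, to which
  Parseval's identity applies. This is the increment hypothesis of the bisection, with exponent
  \<open>2 / q\<close> and with \<open>W\<close> the sum of \<open>\<bar>a k\<bar> powr q\<close>
  over the box.\<close>

lemma nn_integral_cubic_increment:
  fixes a :: "nat ^ 'd \<Rightarrow> real"
  assumes "0 < q" "q \<le> 2" "m \<le> n"
  shows "(\<integral>\<^sup>+t. ennreal ((cmod (trig_sum a (index_box (vec n)) t - trig_sum a (index_box (vec m)) t))\<^sup>2) \<partial>torus_measure)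
      \<le> ennreal (measure lborel (torus :: (real ^ 'd) set) *
          ((\<Sum>k\<in>index_box (vec n). \<bar>a k\<bar> powr q) - (\<Sum>k\<in>index_box (vec m). \<bar>a k\<bar> powr q)) powr (2 / q))"
proof -
  let ?A = "index_box (vec n) - index_box (vec m) :: (nat ^ 'd) set"
  have diff: "sum f (index_box (vec n)) - sum f (index_box (vec m)) = sum f ?A"
    for f :: "nat ^ 'd \<Rightarrow> 'b::ab_group_add"
    by (subst sum_diff) (simp_all add: finite_index_box index_box_vec_mono assms)
  show ?thesis
    unfolding trig_sum_def diff
    by (subst nn_integral_norm_trig_sum)
       (auto intro!: ennreal_leI mult_left_mono sum_power2_le_sum_powr simp: finite_index_box assms)
qed

text \<open>Two regimes of the truncated sum \<open>U\<close>. If \<open>U \<ge> 1\<close>, the mass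
  of the torus is a sufficient bound. If \<open>U < 1\<close>, every coefficient is below
  \<open>l\<close> in modulus, the truncation is inactive, and the maximal inequality with
  Chebyshev's inequality gives a multiple of \<open>U powr (2 / q)\<close>, hence of
  \<open>U\<close>. The constant precedes \<open>a\<close>, \<open>n\<close> and \<open>l\<close>,
  so one value serves all outcomes and scales.\<close>

lemma cubic_maximal_weak_type:
  fixes q :: real
  assumes "0 < q" "q < 2"
  shows "\<exists>C\<ge>0. \<forall>(a :: nat ^ 'd \<Rightarrow> real) n l. l > 0 \<longrightarrow>
    emeasure torus_measure {t \<in> space torus_measure. \<exists>m\<in>{1..n}. cmod (trig_sum a (index_box (vec m)) t) > l}
      \<le> ennreal (C * (\<Sum>k\<in>index_box (vec n). min ((\<bar>a k\<bar> / l) powr q) 1))"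
proof -
  define B where "B = measure lborel (torus :: (real ^ 'd) set)"
  define s where "s = 2 / q"
  \<comment> \<open>Half of the critical value: \<open>(1 + \<eta>) * 2 powr (1 - s) < 1\<close>
    means \<open>\<eta> < 2 powr (s - 1) - 1\<close>.\<close>
  define \<eta> where "\<eta> = (2 powr (s - 1) - 1) / 2"
  define \<rho> where "\<rho> = (1 + \<eta>) * 2 powr (1 - s)"
  \<comment> \<open>The solution of \<open>(1 + 1 / \<eta>) * B + \<rho> * K = K\<close>, the fixed
    point of the bisection recursion.\<close>
  define K where "K = (1 + 1 / \<eta>) * B / (1 - \<rho>)"
  have s: "s > 1" using assms by (simp add: s_def)
  have \<eta>: "\<eta> > 0" using s by (simp add: \<eta>_def)
  have \<rho>: "\<rho> < 1"
  proof -
    have "2 powr (s - 1) * 2 powr (1 - s) = (1::real)" by (simp flip: powr_add)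
    then have "\<rho> = (1 + 2 powr (1 - s)) / 2" by (simp add: \<rho>_def \<eta>_def field_simps)
    moreover have "2 powr (1 - s) < (2::real) powr 0" using s by (subst powr_less_cancel_iff) auto
    ultimately show ?thesis by simp
  qed
  have "B \<ge> 0" by (simp add: B_def)
  then have "K \<ge> 0" using \<eta> \<rho> by (simp add: K_def)
  have K: "(1 + 1 / \<eta>) * B + \<rho> * K \<le> K"
  proof -
    have "(1 + 1 / \<eta>) * B = K * (1 - \<rho>)" using \<rho> by (simp add: K_def)
    then show ?thesis by (simp add: right_diff_distrib mult.commute)
  qed
  have space: "emeasure torus_measure (space (torus_measure :: (real ^ 'd) measure)) = ennreal B"
  proof -
    interpret finite_measure "torus_measure :: (real ^ 'd) measure" by (rule finite_measure_torus)
    show ?thesis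
      by (simp add: emeasure_eq_measure B_def space_restrict_space measure_restrict_space)
  qed
  have "emeasure torus_measure {t \<in> space torus_measure. \<exists>m\<in>{1..n}. cmod (trig_sum a (index_box (vec m)) t) > l}
      \<le> ennreal ((K + B) * (\<Sum>k\<in>index_box (vec n). min ((\<bar>a k\<bar> / l) powr q) 1))"
    if l: "l > 0" for a :: "nat ^ 'd \<Rightarrow> real" and n l
  proof -
    let ?E = "{t \<in> space torus_measure. \<exists>m\<in>{1..n}. cmod (trig_sum a (index_box (vec m)) t) > l}"
    define U where "U = (\<Sum>k\<in>index_box (vec n). min ((\<bar>a k\<bar> / l) powr q) 1)"
    have "U \<ge> 0" by (auto simp: U_def intro!: sum_nonneg)
    have "emeasure torus_measure ?E \<le> ennreal ((K + B) * U)"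
    proof (cases "U \<ge> 1")
      case True
      have "emeasure torus_measure ?E \<le> ennreal B"
        unfolding space[symmetric] by (intro emeasure_mono sets.top) auto
      also have "\<dots> \<le> ennreal ((K + B) * U)"
        using True \<open>B \<ge> 0\<close> \<open>K \<ge> 0\<close> mult_mono[of B "K + B" 1 U] by (intro ennreal_leI) simp
      finally show ?thesis .
    next
      case False
      define W where "W m = (\<Sum>k\<in>index_box (vec m). \<bar>a k\<bar> powr q)" for m
      define S where "S m = trig_sum a (index_box (vec m))" for m
      have small: "\<bar>a k\<bar> powr q = l powr q * min ((\<bar>a k\<bar> / l) powr q) 1" if "k \<in> index_box (vec n)" for k
      proof -
        have "min ((\<bar>a k\<bar> / l) powr q) 1 \<le> U"
          unfolding U_def by (rule member_le_sum) (use that in \<open>auto simp: finite_index_box\<close>)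
        then have "min ((\<bar>a k\<bar> / l) powr q) 1 = (\<bar>a k\<bar> / l) powr q" using False by auto
        then show ?thesis using l by (simp add: powr_divide)
      qed
      have W: "W n - W 0 = l powr q * U"
        by (simp add: W_def U_def index_box_0 sum_distrib_left small)
      have "(\<integral>\<^sup>+t. (SUP m\<in>{0..n}. ennreal ((cmod (S m t - S 0 t))\<^sup>2)) \<partial>torus_measure)
          \<le> ennreal (K * (W n - W 0) powr s)"
      proof (rule bisection_maximal_inequality[where \<eta> = \<eta> and C = B])
        show "mono W"
          unfolding W_def by (intro monoI sum_mono2 finite_index_box index_box_vec_mono) auto
        show "(1 + 1 / \<eta>) * B + (1 + \<eta>) * 2 powr (1 - s) * K \<le> K"
          using K by (simp add: \<rho>_def)
        show "(\<integral>\<^sup>+t. ennreal ((cmod (S b t - S a t))\<^sup>2) \<partial>torus_measure) \<le> ennreal (B * (W b - W a) powr s)"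
          if "a \<le> b" for a b
          unfolding S_def W_def B_def s_def
          by (rule nn_integral_cubic_increment) (use that assms in auto)
      qed (use s \<eta> \<open>B \<ge> 0\<close> \<open>K \<ge> 0\<close> in \<open>auto simp: S_def\<close>)
      \<comment> \<open>Because \<open>q * s = 2\<close>.\<close>
      also have "(W n - W 0) powr s = l\<^sup>2 * U powr s"
        unfolding W using l \<open>U \<ge> 0\<close> assms by (simp add: powr_mult powr_powr s_def)
      finally have max: "(\<integral>\<^sup>+t. (SUP m\<in>{0..n}. ennreal ((cmod (S m t))\<^sup>2)) \<partial>torus_measure)
          \<le> ennreal (K * (l\<^sup>2 * U powr s))"
        by (simp add: S_def index_box_0 trig_sum_def)
      have S_meas [measurable]: "S m \<in> borel_measurable torus_measure" for m
        by (simp add: S_def)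
      \<comment> \<open>Chebyshev's inequality for the squared maximal function, scaled to the
        threshold 1 of the Markov inequality.\<close>
      have "?E \<subseteq> {t \<in> space torus_measure. 1 \<le> ennreal (1 / l\<^sup>2) * (SUP m\<in>{0..n}. ennreal ((cmod (S m t))\<^sup>2))}"
      proof safe
        fix t m assume m: "m \<in> {1..n}" and "l < cmod (trig_sum a (index_box (vec m)) t)"
        then have "l\<^sup>2 \<le> (cmod (S m t))\<^sup>2"
          using l by (intro power_mono) (auto simp: S_def)
        then have "1 \<le> (1 / l\<^sup>2) * (cmod (S m t))\<^sup>2" using l by (simp add: field_simps)
        then have "1 \<le> ennreal (1 / l\<^sup>2) * ennreal ((cmod (S m t))\<^sup>2)"
          by (subst ennreal_mult[symmetric]) auto
        also have "\<dots> \<le> ennreal (1 / l\<^sup>2) * (SUP m\<in>{0..n}. ennreal ((cmod (S m t))\<^sup>2))"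
          using m by (intro mult_left_mono SUP_upper) auto
        finally show "1 \<le> ennreal (1 / l\<^sup>2) * (SUP m\<in>{0..n}. ennreal ((cmod (S m t))\<^sup>2))" .
      qed
      then have "emeasure torus_measure ?E \<le> emeasure torus_measure
          {t \<in> space torus_measure. 1 \<le> ennreal (1 / l\<^sup>2) * (SUP m\<in>{0..n}. ennreal ((cmod (S m t))\<^sup>2))}"
        by (rule emeasure_mono) measurable
      also have "\<dots> \<le> ennreal (1 / l\<^sup>2) *
          (\<integral>\<^sup>+t. (SUP m\<in>{0..n}. ennreal ((cmod (S m t))\<^sup>2)) * indicator (space torus_measure) t \<partial>torus_measure)"
      proof (rule nn_integral_Markov_inequality)
        show "(\<lambda>t. (SUP m\<in>{0..n}. ennreal ((cmod (S m t))\<^sup>2)) * indicator (space torus_measure) t)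
            \<in> borel_measurable torus_measure"
          by (intro borel_measurable_times_ennreal borel_measurable_indicator sets.top) measurable
      qed (rule sets.top)
      also have "\<dots> = ennreal (1 / l\<^sup>2) * (\<integral>\<^sup>+t. (SUP m\<in>{0..n}. ennreal ((cmod (S m t))\<^sup>2)) \<partial>torus_measure)"
        by (intro arg_cong2[where f = "(*)"] nn_integral_cong) auto
      also have "\<dots> \<le> ennreal (1 / l\<^sup>2) * ennreal (K * (l\<^sup>2 * U powr s))"
        by (intro mult_left_mono max) simp
      also have "\<dots> = ennreal (K * U powr s)"
        using l \<open>K \<ge> 0\<close> by (simp flip: ennreal_mult)
      also have "\<dots> \<le> ennreal ((K + B) * U)"
      proof -
        \<comment> \<open>Since \<open>0 \<le> U < 1\<close>, lowering the exponent from
          \<open>s\<close> to 1 increases the power.\<close>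
        have "U powr s \<le> U powr 1"
          using False \<open>U \<ge> 0\<close> s by (intro powr_mono') auto
        then show ?thesis
          using \<open>K \<ge> 0\<close> \<open>B \<ge> 0\<close> \<open>U \<ge> 0\<close> by (intro ennreal_leI mult_mono) auto
      qed
      finally show ?thesis .
    qed
    then show ?thesis by (simp add: U_def)
  qed
  then show ?thesis using \<open>K \<ge> 0\<close> \<open>B \<ge> 0\<close> by (intro exI[of _ "K + B"]) auto
qed

section \<open>Truncated moments\<close>

text \<open>Tonelli's theorem on the region under the graph. Negative values of \<open>f\<close>
  count as 0 on both sides: \<open>ennreal\<close> truncates them, and only levels
  \<open>u \<ge> 0\<close> are integrated.\<close>

lemma nn_integral_layer_cake:
  fixes f :: "'a \<Rightarrow> real"
  assumes "sigma_finite_measure N" and [measurable]: "f \<in> borel_measurable N"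
  shows "(\<integral>\<^sup>+x. ennreal (f x) \<partial>N) = (\<integral>\<^sup>+u. indicator {0..} u * emeasure N {x \<in> space N. f x > u} \<partial>lborel)"
proof -
  interpret N: sigma_finite_measure N by fact
  interpret pair_sigma_finite lborel N ..
  have "(\<integral>\<^sup>+x. ennreal (f x) \<partial>N) = (\<integral>\<^sup>+x. \<integral>\<^sup>+u. indicator {0..<f x} u \<partial>lborel \<partial>N)"
  proof (intro nn_integral_cong)
    fix x show "ennreal (f x) = (\<integral>\<^sup>+u. indicator {0..<f x} u \<partial>lborel)"
      by (cases "0 \<le> f x") (simp_all add: ennreal_neg)
  qed
  \<comment> \<open>As a condition on the pair of \<open>u\<close> and \<open>x\<close>, the
    integrand shows its joint measurability.\<close>
  also have "\<dots> = (\<integral>\<^sup>+x. \<integral>\<^sup>+u. (if 0 \<le> u \<and> u < f x then 1 else 0) \<partial>lborel \<partial>N)"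
    by (intro nn_integral_cong) (auto simp: indicator_def)
  also have "\<dots> = (\<integral>\<^sup>+u. \<integral>\<^sup>+x. (if 0 \<le> u \<and> u < f x then 1 else 0) \<partial>N \<partial>lborel)"
    by (rule Fubini') measurable
  also have "\<dots> = (\<integral>\<^sup>+u. indicator {0..} u * (\<integral>\<^sup>+x. indicator {x \<in> space N. f x > u} x \<partial>N) \<partial>lborel)"
    by (intro nn_integral_cong) (auto simp: indicator_def intro!: nn_integral_cong)
  also have "\<dots> = (\<integral>\<^sup>+u. indicator {0..} u * emeasure N {x \<in> space N. f x > u} \<partial>lborel)"
    by simp
  finally show ?thesis .
qed

text \<open>The truncated power is nondecreasing in the modulus, so its superlevel sets are tail
  events and the layer-cake formula integrates the tail comparison. Only the marginal tails enter,
  never the joint law of the \<open>X k\<close>.\<close>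

lemma truncated_moment_domination:
  fixes X :: "'i \<Rightarrow> 'a \<Rightarrow> real" and Y :: "'a \<Rightarrow> real"
  assumes "prob_space P" "finite A" "c \<ge> 0" "l > 0" "q > 0"
    and X [measurable]: "\<And>k. k \<in> A \<Longrightarrow> X k \<in> borel_measurable P"
    and Y [measurable]: "Y \<in> borel_measurable P"
    and dom: "\<And>x. x \<ge> 0 \<Longrightarrow> (\<Sum>k\<in>A. measure P {\<omega> \<in> space P. \<bar>X k \<omega>\<bar> > x}) \<le> c * measure P {\<omega> \<in> space P. \<bar>Y \<omega>\<bar> > x}"
  shows "(\<Sum>k\<in>A. \<integral>\<^sup>+\<omega>. ennreal (min ((\<bar>X k \<omega>\<bar> / l) powr q) 1) \<partial>P)
     \<le> ennreal c * (\<integral>\<^sup>+\<omega>. ennreal (min ((\<bar>Y \<omega>\<bar> / l) powr q) 1) \<partial>P)"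
proof -
  interpret prob_space P by fact
  let ?h = "\<lambda>x. min ((\<bar>x\<bar> / l) powr q) 1"
  \<comment> \<open>Levels from 1 on are never exceeded; below 1, inverting the power turns
    \<open>u\<close> into a threshold for the modulus.\<close>
  have level: "?h x > u \<longleftrightarrow> u < 1 \<and> \<bar>x\<bar> > l * u powr (1 / q)" if "u \<ge> 0" for x u
  proof -
    have "(\<bar>x\<bar> / l) powr q > u \<longleftrightarrow> (\<bar>x\<bar> / l) powr q > (u powr (1 / q)) powr q"
      using that assms by (simp add: powr_powr)
    also have "\<dots> \<longleftrightarrow> \<bar>x\<bar> / l > u powr (1 / q)"
      using assms powr_less_mono2[of q "u powr (1 / q)" "\<bar>x\<bar> / l"] powr_mono2[of q "\<bar>x\<bar> / l" "u powr (1 / q)"]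
      by (auto simp: not_le[symmetric])
    also have "\<dots> \<longleftrightarrow> \<bar>x\<bar> > l * u powr (1 / q)" using assms by (simp add: field_simps)
    finally show ?thesis by auto
  qed
  have cake: "(\<integral>\<^sup>+\<omega>. ennreal (?h (Z \<omega>)) \<partial>P) = (\<integral>\<^sup>+u. indicator {0..<1} u *
      emeasure P {\<omega> \<in> space P. \<bar>Z \<omega>\<bar> > l * u powr (1 / q)} \<partial>lborel)"
    if [measurable]: "Z \<in> borel_measurable P" for Z
  proof -
    have "(\<integral>\<^sup>+\<omega>. ennreal (?h (Z \<omega>)) \<partial>P) = (\<integral>\<^sup>+u. indicator {0..} u * emeasure P {\<omega> \<in> space P. ?h (Z \<omega>) > u} \<partial>lborel)"
      by (rule nn_integral_layer_cake) (unfold_locales, measurable)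
    also have "\<dots> = (\<integral>\<^sup>+u. indicator {0..<1} u * emeasure P {\<omega> \<in> space P. \<bar>Z \<omega>\<bar> > l * u powr (1 / q)} \<partial>lborel)"
      by (intro nn_integral_cong) (auto simp: indicator_def level simp del: min_less_iff_conj)
    finally show ?thesis .
  qed
  have meas: "(\<lambda>u. emeasure P {\<omega> \<in> space P. \<bar>Z \<omega>\<bar> > l * u powr (1 / q)}) \<in> borel_measurable lborel"
    if [measurable]: "Z \<in> borel_measurable P" for Z
    by measurable
  have "(\<Sum>k\<in>A. \<integral>\<^sup>+\<omega>. ennreal (?h (X k \<omega>)) \<partial>P)
      = (\<integral>\<^sup>+u. (\<Sum>k\<in>A. indicator {0..<1} u * emeasure P {\<omega> \<in> space P. \<bar>X k \<omega>\<bar> > l * u powr (1 / q)}) \<partial>lborel)"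
    by (subst nn_integral_sum) (auto simp: cake intro!: borel_measurable_times_ennreal meas)
  also have "\<dots> \<le> (\<integral>\<^sup>+u. ennreal c * (indicator {0..<1} u * emeasure P {\<omega> \<in> space P. \<bar>Y \<omega>\<bar> > l * u powr (1 / q)}) \<partial>lborel)"
  proof (intro nn_integral_mono)
    fix u
    have "(\<Sum>k\<in>A. emeasure P {\<omega> \<in> space P. \<bar>X k \<omega>\<bar> > l * u powr (1 / q)})
        \<le> ennreal c * emeasure P {\<omega> \<in> space P. \<bar>Y \<omega>\<bar> > l * u powr (1 / q)}"
      using dom[of "l * u powr (1 / q)"] assms
      by (simp add: emeasure_eq_measure flip: ennreal_mult)
    then show "(\<Sum>k\<in>A. indicator {0..<1} u * emeasure P {\<omega> \<in> space P. \<bar>X k \<omega>\<bar> > l * u powr (1 / q)})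
        \<le> ennreal c * (indicator {0..<1} u * emeasure P {\<omega> \<in> space P. \<bar>Y \<omega>\<bar> > l * u powr (1 / q)})"
      by (simp add: indicator_def)
  qed
  also have "\<dots> = ennreal c * (\<integral>\<^sup>+\<omega>. ennreal (?h (Y \<omega>)) \<partial>P)"
    by (subst nn_integral_cmult) (auto simp: cake[OF Y] intro!: borel_measurable_times_ennreal meas)
  finally show ?thesis .
qed

text \<open>The integral comparison in telescoping form: each term is at most \<open>c\<close> times
  the decrement of \<open>n powr (- \<gamma>)\<close>.\<close>

lemma sum_powr_tail_bound:
  fixes \<gamma> :: real
  assumes "\<gamma> > 0" "n0 \<ge> (1::nat)"
  shows "(\<Sum>n=n0..N. real n powr (- \<gamma> - 1)) \<le> 2 powr (\<gamma> + 1) / \<gamma> * real n0 powr (- \<gamma>)"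
proof -
  \<comment> \<open>\<open>1 / \<gamma>\<close> cancels the factor from the derivative of
    \<open>n powr (- \<gamma>)\<close>; \<open>2 powr (\<gamma> + 1)\<close> pays for replacing the
    mean value point \<open>z < n + 1 \<le> 2 * n\<close> by \<open>n\<close>.\<close>
  define c where "c = 2 powr (\<gamma> + 1) / \<gamma>"
  have c: "c > 0" using assms by (simp add: c_def)
  have step: "real n powr (- \<gamma> - 1) \<le> c * real n powr (- \<gamma>) - c * real (Suc n) powr (- \<gamma>)" if n: "n \<ge> 1" for n :: nat
  proof -
    have "\<exists>z. real n < z \<and> z < real (Suc n) \<and>
        real (Suc n) powr (- \<gamma>) - real n powr (- \<gamma>) = (real (Suc n) - real n) * (- \<gamma> * z powr (- \<gamma> - 1))"
      by (intro MVT2) (use n in \<open>auto intro!: derivative_eq_intros\<close>)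
    then obtain z where z: "real n < z" "z < real (Suc n)"
      and eq: "real n powr (- \<gamma>) - real (Suc n) powr (- \<gamma>) = \<gamma> * z powr (- \<gamma> - 1)"
      by auto
    have "(2 * real n) powr (- \<gamma> - 1) \<le> z powr (- \<gamma> - 1)"
      using z n assms by (intro powr_mono2') auto
    then have "real n powr (- \<gamma> - 1) \<le> 2 powr (\<gamma> + 1) * z powr (- \<gamma> - 1)"
      using n by (simp add: powr_mult powr_diff powr_minus powr_add field_simps)
    also have "\<dots> = c * (\<gamma> * z powr (- \<gamma> - 1))" using assms by (simp add: c_def)
    also have "\<dots> = c * real n powr (- \<gamma>) - c * real (Suc n) powr (- \<gamma>)"
      unfolding eq[symmetric] by (simp add: algebra_simps)
    finally show ?thesis .
  qed
  have tele: "(\<Sum>n=n0..<n0 + j. real n powr (- \<gamma> - 1)) \<le> c * real n0 powr (- \<gamma>) - c * real (n0 + j) powr (- \<gamma>)" for j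
  proof (induction j)
    case (Suc j)
    then show ?case using step[of "n0 + j"] assms by simp
  qed simp
  have "(\<Sum>n=n0..N. real n powr (- \<gamma> - 1)) \<le> (\<Sum>n=n0..<n0 + Suc N. real n powr (- \<gamma> - 1))"
    by (intro sum_mono2) auto
  also have "\<dots> \<le> c * real n0 powr (- \<gamma>) - c * real (n0 + Suc N) powr (- \<gamma>)" by (rule tele)
  also have "\<dots> \<le> c * real n0 powr (- \<gamma>)" using c by simp
  finally show ?thesis by (simp add: c_def)
qed

text \<open>The sum is cut near \<open>z\<close>. Below, the minimum is at most 1, and fewer than
  \<open>z\<close> terms are each at most \<open>z powr (\<alpha> - 1)\<close>, as
  \<open>\<alpha> \<ge> 1\<close>. Above, the minimum is at most the power, and the tail with
  exponent \<open>\<beta> - \<alpha>\<close> gives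
  \<open>z powr \<beta> * z powr (- (\<beta> - \<alpha>))\<close>. The bound is uniform in
  \<open>N\<close>.\<close>

lemma sum_truncated_powr_bound:
  fixes \<alpha> \<beta> z :: real
  assumes "1 \<le> \<alpha>" "\<alpha> < \<beta>" "0 \<le> z"
  shows "(\<Sum>n=1..N. real n powr (\<alpha> - 1) * min ((z / real n) powr \<beta>) 1)
           \<le> (1 + 2 powr (\<beta> - \<alpha> + 1) / (\<beta> - \<alpha>)) * z powr \<alpha>"
proof (cases "z = 0")
  case False
  then have z: "z > 0" using assms by simp
  \<comment> \<open>The least integer not below \<open>z\<close>, so that
    \<open>n0 - 1 < z \<le> n0\<close>.\<close>
  define n0 where "n0 = nat \<lceil>z\<rceil>"
  have n0: "n0 \<ge> 1" "real n0 \<ge> z" "real n0 < z + 1"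
    using z unfolding n0_def by linarith+
  define f where "f n = real n powr (\<alpha> - 1) * min ((z / real n) powr \<beta>) 1" for n :: nat
  have f0: "f n \<ge> 0" for n by (simp add: f_def)
  have "(\<Sum>n=1..N. f n) \<le> (\<Sum>n\<in>{1..<n0} \<union> {n0..N}. f n)"
    by (intro sum_mono2) (use f0 in auto)
  also have "\<dots> = (\<Sum>n\<in>{1..<n0}. f n) + (\<Sum>n\<in>{n0..N}. f n)"
    by (intro sum.union_disjoint) auto
  also have "(\<Sum>n\<in>{1..<n0}. f n) \<le> (\<Sum>n\<in>{1..<n0}. z powr (\<alpha> - 1))"
  proof (intro sum_mono)
    fix n assume "n \<in> {1..<n0}"
    then have "real n \<le> z" "n \<ge> 1" using n0 by auto
    then have "f n \<le> real n powr (\<alpha> - 1) * 1"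
      unfolding f_def by (intro mult_left_mono) auto
    also have "\<dots> \<le> z powr (\<alpha> - 1)"
      using \<open>real n \<le> z\<close> assms by (simp add: powr_mono2)
    finally show "f n \<le> z powr (\<alpha> - 1)" .
  qed
  also have "\<dots> = real (n0 - 1) * z powr (\<alpha> - 1)" by simp
  also have "\<dots> \<le> z * z powr (\<alpha> - 1)" using n0 by (intro mult_right_mono) auto
  also have "\<dots> = z powr \<alpha>" using z by (simp add: powr_diff)
  also have "(\<Sum>n\<in>{n0..N}. f n) \<le> (\<Sum>n\<in>{n0..N}. z powr \<beta> * real n powr (- (\<beta> - \<alpha>) - 1))"
  proof (intro sum_mono)
    fix n assume "n \<in> {n0..N}"
    then have n: "real n > 0" using n0 by auto
    have "f n \<le> real n powr (\<alpha> - 1) * (z / real n) powr \<beta>"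
      unfolding f_def by (intro mult_left_mono) auto
    also have "\<dots> = z powr \<beta> * real n powr (- (\<beta> - \<alpha>) - 1)"
      using n z by (simp add: powr_divide powr_diff powr_minus powr_add field_simps)
    finally show "f n \<le> z powr \<beta> * real n powr (- (\<beta> - \<alpha>) - 1)" .
  qed
  also have "\<dots> = z powr \<beta> * (\<Sum>n\<in>{n0..N}. real n powr (- (\<beta> - \<alpha>) - 1))"
    by (simp add: sum_distrib_left)
  also have "\<dots> \<le> z powr \<beta> * (2 powr (\<beta> - \<alpha> + 1) / (\<beta> - \<alpha>) * real n0 powr (- (\<beta> - \<alpha>)))"
    using assms n0 by (intro mult_left_mono sum_powr_tail_bound) auto
  also have "\<dots> \<le> z powr \<beta> * (2 powr (\<beta> - \<alpha> + 1) / (\<beta> - \<alpha>) * z powr (- (\<beta> - \<alpha>)))"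
    using assms n0 z by (intro mult_left_mono powr_mono2') auto
  also have "\<dots> = 2 powr (\<beta> - \<alpha> + 1) / (\<beta> - \<alpha>) * z powr \<alpha>"
    using z by (simp add: powr_diff)
  finally show ?thesis by (simp add: f_def algebra_simps)
qed simp

section \<open>Convergence of the series\<close>

theorem theorem3p4:
  fixes P :: "'a measure"
    and Y :: "'a \<Rightarrow> real"
    and X :: "nat ^ 'd \<Rightarrow> 'a \<Rightarrow> real"
    and M p r :: real
  assumes "prob_space P"
    and "Y \<in> borel_measurable P"
    and "\<And>n. n \<in> pos_lattice \<Longrightarrow> X n \<in> borel_measurable P"
    and "M > 0"
    and "\<And>x n. x \<ge> 0 \<Longrightarrow> n \<in> pos_lattice \<Longrightarrow>
           (1 / real (index_vol n)) * (\<Sum>k\<in>index_box n. measure P {\<omega> \<in> space P. \<bar>X k \<omega>\<bar> > x})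
             \<le> M * measure P {\<omega> \<in> space P. \<bar>Y \<omega>\<bar> > x}"
    and "1 < p" and "p < 2" and "1 \<le> r" and "r \<le> p"
    and "integrable P (\<lambda>\<omega>. \<bar>Y \<omega>\<bar> powr p)"
  shows "\<forall>\<epsilon>>0. AE t in lebesgue. t \<in> torus \<longrightarrow>
           (\<lambda>n::nat. real (index_vol (vec n :: nat ^ 'd)) powr (p / r - 1 - 1 / real CARD('d)) *
              measure P {\<omega> \<in> space P.
                Max ((\<lambda>m. cmod (DFT X (vec m) t \<omega>)) ` {1..n})
                  > \<epsilon> * real (index_vol (vec n :: nat ^ 'd)) powr (1 / r)})
           summable_on {1..}"
proof (intro allI impI)
  fix \<epsilon> :: real assume \<epsilon>: "\<epsilon> > 0"
  note X_meas = assms(3) and dom = assms(5) and p = assms(6,7) and r = assms(8,9)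
  interpret prob_space P by (rule assms(1))
  note Y_meas [measurable] = assms(2)

  \<comment> \<open>Exponents and scales in terms of the side length \<open>n\<close>\<close>
  define d where "d = real CARD('d)"
  \<comment> \<open>The midpoint of \<open>p\<close> and 2: \<open>q < 2\<close> serves the maximal
    inequality, \<open>q > p\<close> the summation over \<open>n\<close>.\<close>
  define q where "q = (p + 2) / 2"
  define w where "w n = real (n ^ CARD('d)) powr (p / r - 1 - 1 / d)" for n :: nat
  define l where "l n = \<epsilon> * real (n ^ CARD('d)) powr (1 / r)" for n :: nat
  \<comment> \<open>Once all scales are powers of \<open>n\<close>, weight times volume has exponent
    \<open>\<alpha> - 1\<close> and the truncated power has exponent \<open>\<beta>\<close>. From
    \<open>r \<le> p\<close> follows \<open>\<alpha> \<ge> 1\<close>, from \<open>p < q\<close>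
    follows \<open>\<alpha> < \<beta>\<close>.\<close>
  define \<alpha> where "\<alpha> = d * p / r"
  define \<beta> where "\<beta> = d * q / r"
  have d: "d \<ge> 1" by (simp add: d_def Suc_le_eq)
  have q: "0 < q" "q < 2" "p < q" using p by (auto simp: q_def)
  have \<alpha>: "1 \<le> \<alpha>"
    using d r mult_mono[of 1 d 1 "p / r"] by (simp add: \<alpha>_def)
  have "\<alpha> < \<beta>"
    using d q r by (simp add: \<alpha>_def \<beta>_def divide_strict_right_mono)
  have vol: "real (n ^ CARD('d)) = real n powr d" for n
    by (cases "n = 0") (simp_all add: d_def powr_realpow)
  have w: "w n * real (n ^ CARD('d)) = real n powr (\<alpha> - 1)" for n
  proof (cases "n = 0")
    case False
    then have "w n * real (n ^ CARD('d)) = real n powr (d * (p / r - 1 - 1 / d) + d)"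
      by (simp only: w_def vol powr_powr powr_add)
    also have "d * (p / r - 1 - 1 / d) + d = \<alpha> - 1"
      using d by (simp add: \<alpha>_def algebra_simps)
    finally show ?thesis .
  qed (simp add: w_def)
  have l: "l n > 0" if "n > 0" for n using that \<epsilon> by (simp add: l_def)
  obtain C where C: "C \<ge> 0" and weak: "\<And>(a :: nat ^ 'd \<Rightarrow> real) n l. l > 0 \<Longrightarrow>
    emeasure torus_measure {t \<in> space torus_measure. \<exists>m\<in>{1..n}. cmod (trig_sum a (index_box (vec m)) t) > l}
      \<le> ennreal (C * (\<Sum>k\<in>index_box (vec n). min ((\<bar>a k\<bar> / l) powr q) 1))"
    using cubic_maximal_weak_type[OF q(1,2)] by blast
  \<comment> \<open>The series may start at \<open>n = 0\<close>, because \<open>0 powr a = 0\<close> makes \<open>w 0\<close> vanish.\<close>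
  define G where "G n = (\<integral>\<^sup>+\<omega>. ennreal (min ((\<bar>Y \<omega>\<bar> / l n) powr q) 1) \<partial>P)" for n
  \<comment> \<open>The event of the series with the maximum spelled out as an existential; at
    \<open>n = 0\<close> it is empty.\<close>
  define E where "E n t = {\<omega> \<in> space P. \<exists>m\<in>{1..n}. cmod (trig_sum (\<lambda>k. X k \<omega>) (index_box (vec m)) t) > l n}" for n t
  define D where "D = 1 + 2 powr (\<beta> - \<alpha> + 1) / (\<beta> - \<alpha>)"
  interpret T: finite_measure "torus_measure :: (real ^ 'd) measure" by (rule finite_measure_torus)
  interpret TP: pair_sigma_finite "torus_measure :: (real ^ 'd) measure" P ..

  \<comment> \<open>Joint measurability of the exceptional events in \<open>t\<close> and
    \<open>\<omega>\<close>\<close>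
  define Q where "Q n = {x \<in> space (torus_measure \<Otimes>\<^sub>M P). \<exists>m\<in>{1..n}.
      cmod (trig_sum (\<lambda>k. X k (snd x)) (index_box (vec m)) (fst x)) > l n}" for n
  \<comment> \<open>Boxes contain only indices with positive coordinates, for which measurability is
    assumed.\<close>
  have X_box: "X k \<in> borel_measurable P" if "k \<in> index_box n" for k n
    using that X_meas by (simp add: index_box_def)
  have Q_meas: "Q n \<in> sets (torus_measure \<Otimes>\<^sub>M P)" for n
  proof -
    have "(\<lambda>x. trig_sum (\<lambda>k. X k (snd x)) (index_box (vec m)) (fst x))
        \<in> borel_measurable (torus_measure \<Otimes>\<^sub>M P)" for m
      unfolding trig_sum_def
    proof (intro borel_measurable_sum)
      fix k :: "nat ^ 'd" assume k: "k \<in> index_box (vec m)"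
      note X_box[OF k, measurable]
      show "(\<lambda>x. exp (\<i> * complex_of_real (phase k (fst x))) * complex_of_real (X k (snd x)))
          \<in> borel_measurable (torus_measure \<Otimes>\<^sub>M P)"
        by measurable
    qed
    note [measurable] = this
    show ?thesis unfolding Q_def by measurable
  qed
  \<comment> \<open>Sections at fixed \<open>t\<close> are the events of the series; sections at
    fixed \<open>\<omega>\<close> are the sets of the weak-type estimate.\<close>
  have Q_fst: "Pair t -` Q n = E n t" if "t \<in> torus" for t n
    using that by (auto simp: Q_def E_def space_pair_measure space_restrict_space)
  have Q_snd: "(\<lambda>t. (t, \<omega>)) -` Q n = {t \<in> space torus_measure.
      \<exists>m\<in>{1..n}. cmod (trig_sum (\<lambda>k. X k \<omega>) (index_box (vec m)) t) > l n}" if "\<omega> \<in> space P" for \<omega> n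
    using that by (auto simp: Q_def space_pair_measure)
  have E_meas: "(\<lambda>t. emeasure P (E n t)) \<in> borel_measurable torus_measure" for n
    using measurable_emeasure_Pair[OF Q_meas[of n]]
    by (rule measurable_cong[THEN iffD1, rotated]) (simp add: Q_fst space_restrict_space)

  \<comment> \<open>Torus integral of a single probability\<close>
  have bound: "(\<integral>\<^sup>+t. emeasure P (E n t) \<partial>torus_measure) \<le> ennreal (C * M * real (n ^ CARD('d))) * G n"
    if n: "n > 0" for n
  proof -
    let ?A = "index_box (vec n) :: (nat ^ 'd) set"
    have "(\<integral>\<^sup>+t. emeasure P (E n t) \<partial>torus_measure) = emeasure (torus_measure \<Otimes>\<^sub>M P) (Q n)"
      unfolding emeasure_pair_measure_alt[OF Q_meas]
      by (intro nn_integral_cong) (simp add: Q_fst space_restrict_space)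
    \<comment> \<open>By Tonelli's theorem the other sections are integrated instead; at a fixed
      outcome the coefficients are numbers, and \<open>weak\<close> applies.\<close>
    also have "\<dots> = (\<integral>\<^sup>+\<omega>. emeasure torus_measure ((\<lambda>t. (t, \<omega>)) -` Q n) \<partial>P)"
      by (rule TP.emeasure_pair_measure_alt2[OF Q_meas])
    also have "\<dots> \<le> (\<integral>\<^sup>+\<omega>. ennreal C * (\<Sum>k\<in>?A. ennreal (min ((\<bar>X k \<omega>\<bar> / l n) powr q) 1)) \<partial>P)"
    proof (intro nn_integral_mono)
      fix \<omega> assume "\<omega> \<in> space P"
      then have "emeasure torus_measure ((\<lambda>t. (t, \<omega>)) -` Q n)
          \<le> ennreal (C * (\<Sum>k\<in>?A. min ((\<bar>X k \<omega>\<bar> / l n) powr q) 1))"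
        using weak[OF l[OF n]] by (simp only: Q_snd)
      also have "\<dots> = ennreal C * (\<Sum>k\<in>?A. ennreal (min ((\<bar>X k \<omega>\<bar> / l n) powr q) 1))"
        using C by (subst ennreal_mult) (auto intro!: sum_nonneg simp: sum_ennreal)
      finally show "emeasure torus_measure ((\<lambda>t. (t, \<omega>)) -` Q n)
          \<le> ennreal C * (\<Sum>k\<in>?A. ennreal (min ((\<bar>X k \<omega>\<bar> / l n) powr q) 1))" .
    qed
    also have "\<dots> = ennreal C * (\<Sum>k\<in>?A. \<integral>\<^sup>+\<omega>. ennreal (min ((\<bar>X k \<omega>\<bar> / l n) powr q) 1) \<partial>P)"
    proof -
      have [measurable]: "X k \<in> borel_measurable P" if "k \<in> ?A" for k using X_box[OF that] .
      show ?thesis by (subst nn_integral_cmult, measurable) (subst nn_integral_sum; simp)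
    qed
    also have "\<dots> \<le> ennreal C * (ennreal (M * real (n ^ CARD('d))) * G n)"
      unfolding G_def
    proof (intro mult_left_mono truncated_moment_domination)
      fix x :: real assume "x \<ge> 0"
      \<comment> \<open>The mean domination for the cube \<open>vec n\<close>, multiplied by its
        volume.\<close>
      then show "(\<Sum>k\<in>?A. measure P {\<omega> \<in> space P. \<bar>X k \<omega>\<bar> > x})
          \<le> M * real (n ^ CARD('d)) * measure P {\<omega> \<in> space P. \<bar>Y \<omega>\<bar> > x}"
        using dom[of x "vec n"] n by (simp add: index_vol_vec pos_lattice_def field_simps)
    qed (use \<open>M > 0\<close> q l[OF n] X_box prob_space_axioms in \<open>auto simp: finite_index_box\<close>)
    also have "\<dots> = ennreal (C * M * real (n ^ CARD('d))) * G n"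
      using C \<open>M > 0\<close> by (simp add: ennreal_mult mult_ac)
    finally show ?thesis .
  qed

  \<comment> \<open>Summation of the truncated moments over \<open>n\<close>\<close>
  have series: "(\<Sum>n. ennreal (real n powr (\<alpha> - 1)) * G n) \<le> (\<integral>\<^sup>+\<omega>. ennreal (D * (\<bar>Y \<omega>\<bar> / \<epsilon>) powr p) \<partial>P)"
  proof -
    have "(\<Sum>n. ennreal (real n powr (\<alpha> - 1)) * G n)
        = (\<integral>\<^sup>+\<omega>. (\<Sum>n. ennreal (real n powr (\<alpha> - 1)) * ennreal (min ((\<bar>Y \<omega>\<bar> / l n) powr q) 1)) \<partial>P)"
      unfolding G_def by (subst nn_integral_suminf) (auto simp: nn_integral_cmult)
    also have "\<dots> \<le> (\<integral>\<^sup>+\<omega>. ennreal (D * (\<bar>Y \<omega>\<bar> / \<epsilon>) powr p) \<partial>P)"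
    proof (intro nn_integral_mono)
      fix \<omega>
      \<comment> \<open>The real side length at which the level \<open>l\<close> would equal
        \<open>\<bar>Y \<omega>\<bar>\<close>; the truncation changes regime there.\<close>
      define z where "z = (\<bar>Y \<omega>\<bar> / \<epsilon>) powr (r / d)"
      have "z \<ge> 0" by (simp add: z_def)
      \<comment> \<open>This includes \<open>n = 0\<close>, where division by zero makes both sides
        vanish.\<close>
      have ratio: "(\<bar>Y \<omega>\<bar> / l n) powr q = (z / real n) powr \<beta>" for n
      proof -
        have "l n = \<epsilon> * real n powr (d / r)"
          by (simp add: l_def vol powr_powr del: of_nat_power)
        then have "(\<bar>Y \<omega>\<bar> / l n) powr q = (\<bar>Y \<omega>\<bar> / \<epsilon>) powr q / real n powr (d / r * q)"
          using \<epsilon> by (simp add: powr_divide powr_mult powr_powr)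
        also have "(\<bar>Y \<omega>\<bar> / \<epsilon>) powr q = z powr \<beta>"
          using d r by (simp add: z_def \<beta>_def powr_powr)
        finally show ?thesis
          using \<open>z \<ge> 0\<close> by (simp add: powr_divide \<beta>_def)
      qed
      have "z powr \<alpha> = (\<bar>Y \<omega>\<bar> / \<epsilon>) powr p"
        using d r by (simp add: z_def \<alpha>_def powr_powr)
      have "(\<Sum>n<N. real n powr (\<alpha> - 1) * min ((z / real n) powr \<beta>) 1) \<le> D * z powr \<alpha>" for N
      proof -
        have "(\<Sum>n<N. real n powr (\<alpha> - 1) * min ((z / real n) powr \<beta>) 1)
            \<le> (\<Sum>n\<in>{0..N}. real n powr (\<alpha> - 1) * min ((z / real n) powr \<beta>) 1)"
          by (intro sum_mono2) auto
        \<comment> \<open>The term at 0 vanishes because \<open>0 powr (\<alpha> - 1) = 0\<close>,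
          even for \<open>\<alpha> = 1\<close>.\<close>
        also have "\<dots> = (\<Sum>n=1..N. real n powr (\<alpha> - 1) * min ((z / real n) powr \<beta>) 1)"
          by (intro sum.mono_neutral_right) auto
        also have "\<dots> \<le> D * z powr \<alpha>"
          unfolding D_def by (rule sum_truncated_powr_bound) fact+
        finally show ?thesis .
      qed
      then have "(\<Sum>n<N. ennreal (real n powr (\<alpha> - 1)) * ennreal (min ((\<bar>Y \<omega>\<bar> / l n) powr q) 1))
          \<le> ennreal (D * (\<bar>Y \<omega>\<bar> / \<epsilon>) powr p)" for N
        unfolding ratio \<open>z powr \<alpha> = _\<close>[symmetric]
        by (subst ennreal_mult[symmetric]; simp add: sum_ennreal ennreal_leI)
      then show "(\<Sum>n. ennreal (real n powr (\<alpha> - 1)) * ennreal (min ((\<bar>Y \<omega>\<bar> / l n) powr q) 1))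
          \<le> ennreal (D * (\<bar>Y \<omega>\<bar> / \<epsilon>) powr p)"
        by (intro suminf_le_const) auto
    qed
    finally show ?thesis .
  qed
  have moment: "(\<integral>\<^sup>+\<omega>. ennreal (D * (\<bar>Y \<omega>\<bar> / \<epsilon>) powr p) \<partial>P) < \<infinity>"
  proof -
    have "integrable P (\<lambda>\<omega>. (D / \<epsilon> powr p) * \<bar>Y \<omega>\<bar> powr p)"
      using assms(10) by simp
    then have "integrable P (\<lambda>\<omega>. D * (\<bar>Y \<omega>\<bar> / \<epsilon>) powr p)"
      using \<epsilon> by (simp add: powr_divide)
    from integrableD(2)[OF this] show ?thesis by (simp add: less_top)
  qed

  \<comment> \<open>From the integrated series to almost every \<open>t\<close>\<close>
  have "(\<integral>\<^sup>+t. (\<Sum>n. ennreal (w n) * emeasure P (E n t)) \<partial>torus_measure)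
      = (\<Sum>n. ennreal (w n) * (\<integral>\<^sup>+t. emeasure P (E n t) \<partial>torus_measure))"
    using E_meas by (simp add: nn_integral_suminf nn_integral_cmult)
  also have "\<dots> \<le> (\<Sum>n. ennreal (C * M) * (ennreal (real n powr (\<alpha> - 1)) * G n))"
  proof (intro suminf_le)
    fix n
    show "ennreal (w n) * (\<integral>\<^sup>+t. emeasure P (E n t) \<partial>torus_measure)
        \<le> ennreal (C * M) * (ennreal (real n powr (\<alpha> - 1)) * G n)"
    proof (cases "n = 0")
      case False
      then have "ennreal (w n) * (\<integral>\<^sup>+t. emeasure P (E n t) \<partial>torus_measure)
          \<le> ennreal (w n) * (ennreal (C * M * real (n ^ CARD('d))) * G n)"
        by (intro mult_left_mono bound) auto
      also have "\<dots> = ennreal (C * M) * (ennreal (real n powr (\<alpha> - 1)) * G n)"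
      proof -
        have "ennreal (w n) * ennreal (C * M * real (n ^ CARD('d))) = ennreal (C * M) * ennreal (real n powr (\<alpha> - 1))"
          using C \<open>M > 0\<close> unfolding w[symmetric]
          by (simp add: w_def mult_ac flip: ennreal_mult)
        then show ?thesis by (metis mult.assoc)
      qed
      finally show ?thesis .
    qed (simp add: w_def)
  qed auto
  also have "\<dots> = ennreal (C * M) * (\<Sum>n. ennreal (real n powr (\<alpha> - 1)) * G n)"
    by simp
  also have "\<dots> \<le> ennreal (C * M) * (\<integral>\<^sup>+\<omega>. ennreal (D * (\<bar>Y \<omega>\<bar> / \<epsilon>) powr p) \<partial>P)"
    by (intro mult_left_mono series) simp
  also have "\<dots> < \<infinity>"
    using moment by (simp add: ennreal_mult_less_top)
  finally have "AE t in torus_measure. (\<Sum>n. ennreal (w n) * emeasure P (E n t)) \<noteq> \<infinity>"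
    using E_meas by (intro nn_integral_PInf_AE) auto
  then have "AE t in lborel. t \<in> torus \<longrightarrow> (\<Sum>n. ennreal (w n) * emeasure P (E n t)) \<noteq> \<infinity>"
    by (subst (asm) AE_restrict_space_iff) auto
  \<comment> \<open>\<open>lebesgue\<close> is the completion of \<open>lborel\<close>, in which
    null sets remain null.\<close>
  then have "AE t in lebesgue. t \<in> torus \<longrightarrow> (\<Sum>n. ennreal (w n) * emeasure P (E n t)) \<noteq> \<infinity>"
    by (rule AE_completion)
  then show "AE t in lebesgue. t \<in> torus \<longrightarrow>
      (\<lambda>n::nat. real (index_vol (vec n :: nat ^ 'd)) powr (p / r - 1 - 1 / real CARD('d)) *
        measure P {\<omega> \<in> space P. Max ((\<lambda>m. cmod (DFT X (vec m) t \<omega>)) ` {1..n})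
          > \<epsilon> * real (index_vol (vec n :: nat ^ 'd)) powr (1 / r)})
      summable_on {1..}"
  proof (eventually_elim, intro impI)
    fix t :: "real ^ 'd"
    assume "t \<in> torus \<longrightarrow> (\<Sum>n. ennreal (w n) * emeasure P (E n t)) \<noteq> \<infinity>" and "t \<in> torus"
    then have "(\<Sum>n. ennreal (w n * measure P (E n t))) \<noteq> top"
      by (simp add: emeasure_eq_measure ennreal_mult w_def)
    then have "summable (\<lambda>n. w n * measure P (E n t))"
      by (intro summable_suminf_not_top) (auto simp: w_def)
    \<comment> \<open>The terms are nonnegative, so convergence in the natural order is already
      absolute and gives unordered summability.\<close>
    then have "(\<lambda>n. w n * measure P (E n t)) summable_on UNIV"
      by (intro norm_summable_imp_summable_on) (simp add: w_def)
    then have "(\<lambda>n. w n * measure P (E n t)) summable_on {1..}"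
      by (rule summable_on_subset_banach) simp
    then show "(\<lambda>n::nat. real (index_vol (vec n :: nat ^ 'd)) powr (p / r - 1 - 1 / real CARD('d)) *
        measure P {\<omega> \<in> space P. Max ((\<lambda>m. cmod (DFT X (vec m) t \<omega>)) ` {1..n})
          > \<epsilon> * real (index_vol (vec n :: nat ^ 'd)) powr (1 / r)})
      summable_on {1..}"
    proof (rule summable_on_cong[THEN iffD1, rotated])
      fix n :: nat assume "n \<in> {1..}"
      \<comment> \<open>For \<open>n \<ge> 1\<close> the set under \<open>Max\<close> is nonempty,
        so its maximum exceeds the level exactly when some member does.\<close>
      then have "{\<omega> \<in> space P. Max ((\<lambda>m. cmod (DFT X (vec m) t \<omega>)) ` {1..n})
          > \<epsilon> * real (index_vol (vec n :: nat ^ 'd)) powr (1 / r)} = E n t"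
        by (subst Max_gr_iff) (auto simp: E_def l_def DFT_def trig_sum_def index_vol_vec)
      then show "w n * measure P (E n t) = real (index_vol (vec n :: nat ^ 'd)) powr (p / r - 1 - 1 / real CARD('d)) *
        measure P {\<omega> \<in> space P. Max ((\<lambda>m. cmod (DFT X (vec m) t \<omega>)) ` {1..n})
          > \<epsilon> * real (index_vol (vec n :: nat ^ 'd)) powr (1 / r)}"
        by (simp add: w_def d_def index_vol_vec)
    qed
  qed
qed

end
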